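(* Let $E$ be a separable Banach space, $1<p<\infty$, $p^{-1}+q^{-1}=1$, $\phi=p^{-1}\|\cdot\|^p$, and let $f:\Omega\times E\to\mathbb{R}$ be a measurable integrand. The following assertions are equivalent: (a) for every $x_0\in L_p(\Omega,E)$ the integrand $f$ satisfies condition $(\mathcal{S}_{\phi,x_0})$; (b) there exists $x_0\in L_p(\Omega,E)$ such that $f$ satisfies condition $(\mathcal{S}_{\phi,x_0})$; (c) the integrand $f$ satisfies condition $(\mathcal{S}_p)$. Moreover, when they hold, the integrand $f$ has the Fréchet-differential lower compactness property on $L_p(\Omega,E)$ at every $x_0\in L_p(\Omega,E)$.
   Context: $(\Omega,\mathbb{T},\mu)$ is a measure space with $\mu$ a $\sigma$-finite positive measure and $\mathbb{T}$ $\mu$-complete. A measurable integrand is a $\mathbb{T}\otimes\mathcal{B}(E)$-measurable function; $f_\omega=f(\omega,\cdot)$. $\partial^C$ denotes the Clarke subdifferential of a locally Lipschitz function. $\|\cdot\|_*$ is the norm of $E^*$. For $\phi=p^{-1}\|\cdot\|^p$, $\phi^*=q^{-1}\|\cdot\|_*^q$. Condition $(\mathcal{S}_{\phi,x_0})$: for almost every $\omega$, $f_\omega$ is Lipschitzian on every ball of $E$; and there exist positive constants $c,\lambda_0$ such that for every $\lambda>\lambda_0$ there exist $\beta>0$ and $u_\lambda\in L_1(\Omega,\mathbb{R})$ with, for almost every $\omega$ and every $e\in E$, $\sup_{e^*\in\partial^Cf_\omega(x_0(\omega)+e)}\phi^*(\lambda e^* )\le c\,\phi(\beta e)+u_\lambda(\omega)$.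 Condition $(\mathcal{S}_p)$: for almost every $\omega$, $f_\omega$ is Lipschitzian on every ball of $E$; and there exist a positive constant $c$ and a non negative function $a\in L_q(\Omega,\mathbb{R})$ such that, for almost every $\omega$, for every $e\in E$ and $e^*\in\partial^Cf_\omega(e)$, $\|e^*\|_*\le c\|e\|^{p-1}+a(\omega)$. A subset $X$ of $L_1(\Omega,\mathbb{R})$ is uniformly integrable if it is bounded in $L_1$ and for every $\epsilon>0$ there are $\eta>0$ and a measurable $K$ of finite measure with $\sup_{u\in X}\|u1_A\|_1<\epsilon$ whenever $\mu(A)\le\eta$, and $\sup_{u\in X}\|u1_{K^c}\|_1<\epsilon$. $f$ has the Fréchet-differential lower compactness property on $L_p(\Omega,E)$ at $x_0$ if for every sequence $(r_n)_n$ of positive numbers converging to $0$ and every norm bounded sequence $(x_n)_n$ in $L_p(\Omega,E)$ there is $n_0$ such that the negative parts of $\omega\mapsto r_n^{-1}(f(\omega,x_0(\omega)+r_nx_n(\omega))-f(\omega,x_0(\omega)))$, $n\ge n_0$, form a uniformly integrable family in $L_1(\Omega,\mathbb{R})$. *)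

theory Defs
  imports "HOL-Analysis.Analysis"
begin

section \<open>Integrands and Lebesgue-Bochner spaces\<close>

definition measurable_integrand :: "'w measure \<Rightarrow> ('w \<Rightarrow> 'a::topological_space \<Rightarrow> real) \<Rightarrow> bool" where
  "measurable_integrand M f \<longleftrightarrow> (\<lambda>(w, e). f w e) \<in> borel_measurable (M \<Otimes>\<^sub>M borel)"

text \<open>
  Elements of \<open>L\<^sub>p\<close> are represented by functions rather than classes modulo equality almost
  everywhere. The range is second countable, so that Borel measurability is strong measurability.
\<close>

definition Lp_space ::
    "real \<Rightarrow> 'w measure \<Rightarrow> ('w \<Rightarrow> 'a::{real_normed_vector, second_countable_topology}) set" where
  "Lp_space p M = {x \<in> borel_measurable M. integrable M (\<lambda>w. norm (x w) powr p)}"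

definition Lp_norm :: "real \<Rightarrow> 'w measure \<Rightarrow> ('w \<Rightarrow> 'a::real_normed_vector) \<Rightarrow> real" where
  "Lp_norm p M x = (LINT w|M. norm (x w) powr p) powr (1 / p)"


section \<open>Clarke subdifferential and conjugate\<close>

text \<open>
  In \<open>nhds x \<times>\<^sub>F at_right 0\<close> the base point \<open>y\<close> tends to \<open>x\<close> (the value \<open>y = x\<close> being
  allowed) while \<open>t\<close> decreases to \<open>0\<close>.
\<close>

definition clarke_derivative :: "('a::real_normed_vector \<Rightarrow> real) \<Rightarrow> 'a \<Rightarrow> 'a \<Rightarrow> ereal" where
  "clarke_derivative g x v =
     Limsup (nhds x \<times>\<^sub>F at_right 0) (\<lambda>(y, t). ereal ((g (y + t *\<^sub>R v) - g y) / t))"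

definition clarke_subdifferential ::
    "('a::real_normed_vector \<Rightarrow> real) \<Rightarrow> 'a \<Rightarrow> ('a \<Rightarrow>\<^sub>L real) set" where
  "clarke_subdifferential g x = {l. \<forall>v. ereal (blinfun_apply l v) \<le> clarke_derivative g x v}"

definition conjugate :: "('a::real_normed_vector \<Rightarrow> real) \<Rightarrow> ('a \<Rightarrow>\<^sub>L real) \<Rightarrow> ereal" where
  "conjugate \<phi> l = (SUP e. ereal (blinfun_apply l e - \<phi> e))"

definition power_phi :: "real \<Rightarrow> 'a::real_normed_vector \<Rightarrow> real" where
  "power_phi p e = norm e powr p / p"

lemma conjugate_power_phi:
  fixes l :: "'a::real_normed_vector \<Rightarrow>\<^sub>L real" and p q :: real
  assumes p: "1 < p" and pq: "1 / p + 1 / q = 1"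
  shows "conjugate (power_phi p) l = ereal (norm l powr q / q)"
proof (rule antisym)
  have q: "q > 1" using p pq
    by (smt (verit) divide_less_eq_1_pos divide_nonneg_nonpos zero_less_divide_1_iff)
  show "conjugate (power_phi p) l \<le> ereal (norm l powr q / q)"
    unfolding conjugate_def
  proof (rule SUP_least)
    fix e :: 'a
    have "blinfun_apply l e \<le> norm l * norm e"
      using norm_blinfun[of l e] by simp
    also have "\<dots> \<le> norm e powr p / p + norm l powr q / q"
      using Youngs_inequality[of p q "norm e" "norm l"] p q pq by (simp add: mult.commute)
    finally show "ereal (blinfun_apply l e - power_phi p e) \<le> ereal (norm l powr q / q)"
      by (simp add: power_phi_def)
  qed
  show "ereal (norm l powr q / q) \<le> conjugate (power_phi p) l"
  proof (cases "l = 0")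
    case True
    have "ereal (blinfun_apply l 0 - power_phi p (0::'a)) \<le> conjugate (power_phi p) l"
      unfolding conjugate_def by (rule SUP_upper2[of 0]) simp_all
    then show ?thesis using True p by (simp add: power_phi_def zero_ereal_def)
  next
    case False
    have qp: "(q - 1) * p = q" and qq: "1 - 1 / p = 1 / q"
      using p q pq by (auto simp: field_simps)
    have less: "ereal (s powr q / q) \<le> conjugate (power_phi p) l" if s: "0 < s" "s < norm l" for s
    proof -
      obtain e where e: "s * norm e < \<bar>blinfun_apply l e\<bar>"
        using norm_blinfun_bound[of s l] s unfolding real_norm_def
        by (meson less_le_not_le linorder_not_le)
      then have ne: "norm e > 0" by auto
      define t where "t = s powr (q - 1)"
      have t: "t > 0" using s by (simp add: t_def)
      define e' where "e' = (sgn (blinfun_apply l e) * t / norm e) *\<^sub>R e"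
      have le: "blinfun_apply l e' = t * (\<bar>blinfun_apply l e\<bar> / norm e)"
        by (simp add: e'_def blinfun.scaleR_right abs_sgn mult_ac)
      have "s * t < blinfun_apply l e'"
        unfolding le using e ne t by (simp add: field_simps)
      moreover have "s * t = s powr q"
        using s powr_add[of s 1 "q - 1"] by (simp add: t_def)
      moreover have "blinfun_apply l e \<noteq> 0" using e s ne
        by (smt (verit) mult_pos_pos)
      then have "norm e' = t"
        using ne t by (simp add: e'_def abs_mult abs_sgn_eq)
      then have "power_phi p e' = s powr q / p"
        using qp by (simp add: power_phi_def t_def powr_powr)
      moreover have "s powr q - s powr q / p = s powr q / q"
        using arg_cong[OF qq, of "\<lambda>x. s powr q * x"] by (simp add: algebra_simps)
      ultimately have "s powr q / q \<le> blinfun_apply l e' - power_phi p e'" by linarith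
      then have "ereal (s powr q / q) \<le> ereal (blinfun_apply l e' - power_phi p e')" by simp
      also have "\<dots> \<le> conjugate (power_phi p) l"
        unfolding conjugate_def by (rule SUP_upper2[of e']) simp_all
      finally show ?thesis .
    qed
    have "((\<lambda>s. s powr q / q) \<longlongrightarrow> norm l powr q / q) (at_left (norm l))"
      using False q by (intro tendsto_intros) auto
    then have lim: "((\<lambda>s. ereal (s powr q / q)) \<longlongrightarrow> ereal (norm l powr q / q)) (at_left (norm l))"
      by simp
    have "eventually (\<lambda>s. s \<in> {0<..<norm l}) (at_left (norm l))"
      using False by (intro eventually_at_leftI[of 0]) auto
    then have "eventually (\<lambda>s. ereal (s powr q / q) \<le> conjugate (power_phi p) l) (at_left (norm l))"
      by eventually_elim (use less in auto)
    then show ?thesis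
      using lim by (intro tendsto_upperbound[OF lim]) auto
  qed
qed


section \<open>Growth conditions\<close>

definition lipschitz_on_balls :: "('a::metric_space \<Rightarrow> real) \<Rightarrow> bool" where
  "lipschitz_on_balls g \<longleftrightarrow> (\<forall>x r. \<exists>L. L-lipschitz_on (ball x r) g)"

definition condition_S_phi ::
    "'w measure \<Rightarrow> ('a::real_normed_vector \<Rightarrow> real) \<Rightarrow> ('w \<Rightarrow> 'a) \<Rightarrow> ('w \<Rightarrow> 'a \<Rightarrow> real) \<Rightarrow> bool" where
  "condition_S_phi M \<phi> x0 f \<longleftrightarrow>
     (AE w in M. lipschitz_on_balls (f w)) \<and>
     (\<exists>c>0. \<exists>k0>0. \<forall>k>k0. \<exists>\<beta>>0. \<exists>u. integrable M u \<and>
        (AE w in M. \<forall>e.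
           (SUP l\<in>clarke_subdifferential (f w) (x0 w + e). conjugate \<phi> (k *\<^sub>R l))
             \<le> ereal (c * \<phi> (\<beta> *\<^sub>R e) + u w)))"

text \<open>The parameter \<open>q\<close> is meant to be the conjugate exponent of \<open>p\<close>.\<close>

definition condition_S ::
    "'w measure \<Rightarrow> real \<Rightarrow> real \<Rightarrow> ('w \<Rightarrow> 'a::real_normed_vector \<Rightarrow> real) \<Rightarrow> bool" where
  "condition_S M p q f \<longleftrightarrow>
     (AE w in M. lipschitz_on_balls (f w)) \<and>
     (\<exists>c>0. \<exists>a\<in>Lp_space q M. (\<forall>w\<in>space M. 0 \<le> a w) \<and>
        (AE w in M. \<forall>e. \<forall>l\<in>clarke_subdifferential (f w) e.
           norm l \<le> c * norm e powr (p - 1) + a w))"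


section \<open>Uniform integrability and lower compactness\<close>

text \<open>
  The suprema of \<open>L\<^sub>1\<close>-norms in the last clause are computed as nonnegative
  integrals so that the suprema always exist.
\<close>

definition uniformly_integrable :: "'w measure \<Rightarrow> ('w \<Rightarrow> real) set \<Rightarrow> bool" where
  "uniformly_integrable M X \<longleftrightarrow>
     (\<forall>u\<in>X. integrable M u) \<and>
     (\<exists>C. \<forall>u\<in>X. (LINT w|M. \<bar>u w\<bar>) \<le> C) \<and>
     (\<forall>\<epsilon>::real. \<epsilon> > 0 \<longrightarrow>
        (\<exists>\<eta>::real. \<exists>K. \<eta> > 0 \<and> K \<in> sets M \<and> emeasure M K < \<infinity> \<and>
           (\<forall>A\<in>sets M. emeasure M A \<le> ennreal \<eta> \<longrightarrow>
              (SUP u\<in>X. \<integral>\<^sup>+ w. ennreal \<bar>u w * indicator A w\<bar> \<partial>M) < ennreal \<epsilon>) \<and>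
           (SUP u\<in>X. \<integral>\<^sup>+ w. ennreal \<bar>u w * indicator (space M - K) w\<bar> \<partial>M) < ennreal \<epsilon>))"

definition frechet_lower_compactness ::
    "'w measure \<Rightarrow> real \<Rightarrow> ('w \<Rightarrow> 'a::{real_normed_vector, second_countable_topology}) \<Rightarrow>
     ('w \<Rightarrow> 'a \<Rightarrow> real) \<Rightarrow> bool" where
  "frechet_lower_compactness M p x0 f \<longleftrightarrow>
     (\<forall>(r :: nat \<Rightarrow> real) (x :: nat \<Rightarrow> 'w \<Rightarrow> 'a).
        (\<forall>n. 0 < r n) \<longrightarrow> r \<longlonglongrightarrow> 0 \<longrightarrow>
        (\<forall>n. x n \<in> Lp_space p M) \<longrightarrow> (\<exists>B. \<forall>n. Lp_norm p M (x n) \<le> B) \<longrightarrow>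
        (\<exists>n0. uniformly_integrable M
           ((\<lambda>n w. max 0 (- ((f w (x0 w + r n *\<^sub>R x n w) - f w (x0 w)) / r n))) ` {n0..})))"

end

theory Submission
  imports Defs
begin

text \<open>
  The conjugate of \<open>norm e powr p / p\<close> is \<open>norm l powr q / q\<close>, and \<open>(p - 1) * q = p\<close>. Hence a growth of
  order \<open>p - 1\<close> of the Clarke subgradients with a remainder in \<open>L\<^sub>q\<close>, and a growth of order \<open>p\<close> of their
  conjugate values with a remainder in \<open>L\<^sub>1\<close>, are the same thing up to taking \<open>q\<close>-th powers or roots.
  Moving the base point by \<open>x0 w\<close> costs a multiple of \<open>norm (x0 w) powr p\<close>, which is integrable exactly
  because \<open>x0\<close> is in \<open>L\<^sub>p\<close>; so the choice of \<open>x0\<close> does not matter. This gives the equivalence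
  (\<open>condition_S_phi_imp_condition_S\<close>, \<open>condition_S_imp_condition_S_phi\<close>).

  For lower compactness, the growth of the subgradients must be converted into a bound on difference
  quotients. The Clarke derivative of a locally Lipschitz function is a finite sublinear functional of
  the direction, so by the Hahn-Banach theorem it is attained by an element of the subdifferential
  (\<open>clarke_derivative_attained\<close>). A norm bound on all subgradients along a segment is therefore a bound
  on the Clarke derivative there, hence on the increment of the function
  (\<open>clarke_mean_value_inequality\<close>). For the quotients at \<open>x0\<close> along \<open>x n\<close> with step \<open>r n\<close> this gives the
  bound \<open>h * norm (x n) + D * r n powr (p - 1) * norm (x n) powr p\<close> with \<open>h\<close> in \<open>L\<^sub>q\<close>. The second term
  tends to \<open>0\<close> in \<open>L\<^sub>1\<close>. By Young's inequality the first one is at most a fixed integrable function plus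
  an arbitrarily small multiple of \<open>norm (x n) powr p\<close>. Such a domination up to small errors implies
  uniform integrability (\<open>uniformly_integrable_rangeI\<close>).
\<close>


section \<open>Sublinear functionals\<close>

definition sublinear :: "('a::real_vector \<Rightarrow> real) \<Rightarrow> bool" where
  "sublinear s \<longleftrightarrow> (\<forall>x y. s (x + y) \<le> s x + s y) \<and> (\<forall>t>0. \<forall>x. s (t *\<^sub>R x) \<le> t * s x)"

lemma sublinear_add: "sublinear s \<Longrightarrow> s (x + y) \<le> s x + s y"
  and sublinear_scaleR_le: "sublinear s \<Longrightarrow> 0 < t \<Longrightarrow> s (t *\<^sub>R x) \<le> t * s x"
  by (auto simp: sublinear_def)

lemma sublinear_0:
  assumes "sublinear s" shows "s 0 = 0"
  using sublinear_scaleR_le[OF assms, of 2 0] sublinear_scaleR_le[OF assms, of "1/2" 0] by simp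

lemma sublinear_scaleR:
  assumes "sublinear s" "0 \<le> t" shows "s (t *\<^sub>R x) = t * s x"
proof (cases "t = 0")
  case False
  with assms have t: "t > 0" by simp
  have "s (inverse t *\<^sub>R (t *\<^sub>R x)) \<le> inverse t * s (t *\<^sub>R x)"
    using t by (intro sublinear_scaleR_le assms(1)) simp
  then have "t * s x \<le> s (t *\<^sub>R x)"
    using t by (simp add: inverse_eq_divide pos_le_divide_eq mult.commute)
  with sublinear_scaleR_le[OF assms(1) t, of x] show ?thesis by simp
qed (simp add: sublinear_0 assms)

lemma sublinear_minus_le: "sublinear s \<Longrightarrow> - s (- x) \<le> s x"
  using sublinear_add[of s x "- x"] sublinear_0[of s] by simp

text \<open>
  For a sublinear \<open>s\<close> this is the largest sublinear functional below \<open>s\<close> whose value at \<open>- v\<close>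
  is at most \<open>- s v\<close>; a linear functional below it must therefore agree with \<open>s\<close> at \<open>v\<close>.
\<close>

definition sublinear_along :: "('a::real_vector \<Rightarrow> real) \<Rightarrow> 'a \<Rightarrow> 'a \<Rightarrow> real" where
  "sublinear_along s v y = (INF t\<in>{0..}. s (y + t *\<^sub>R v) - t * s v)"

lemma sublinear_along_le:
  assumes "sublinear s" "0 \<le> t"
  shows "sublinear_along s v y \<le> s (y + t *\<^sub>R v) - t * s v"
  unfolding sublinear_along_def
proof (rule cINF_lower)
  show "bdd_below ((\<lambda>t. s (y + t *\<^sub>R v) - t * s v) ` {0..})"
  proof (rule bdd_belowI2)
    fix t :: real assume "t \<in> {0..}"
    then show "- s (- y) \<le> s (y + t *\<^sub>R v) - t * s v"
      using sublinear_add[OF assms(1), of "y + t *\<^sub>R v" "- y"] sublinear_scaleR[OF assms(1), of t v]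
      by simp
  qed
qed (use assms in simp)

lemma sublinear_along_greatest:
  assumes "\<And>t. 0 \<le> t \<Longrightarrow> c \<le> s (y + t *\<^sub>R v) - t * s v"
  shows "c \<le> sublinear_along s v y"
  unfolding sublinear_along_def using assms by (intro cINF_greatest) auto

lemma sublinear_along_le_self: "sublinear s \<Longrightarrow> sublinear_along s v y \<le> s y"
  using sublinear_along_le[of s 0 v y] by simp

lemma sublinear_along_minus: "sublinear s \<Longrightarrow> sublinear_along s v (- v) \<le> - s v"
  using sublinear_along_le[of s 1 v "- v"] by (simp add: sublinear_0)

lemma sublinear_sublinear_along:
  assumes s: "sublinear s"
  shows "sublinear (sublinear_along s v)"
  unfolding sublinear_def
proof safe
  fix x y
  have "sublinear_along s v (x + y) - (s (x + t *\<^sub>R v) - t * s v) \<le> s (y + u *\<^sub>R v) - u * s v"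
    if "0 \<le> t" "0 \<le> u" for t u
  proof -
    have "sublinear_along s v (x + y) \<le> s ((x + t *\<^sub>R v) + (y + u *\<^sub>R v)) - (t + u) * s v"
      using sublinear_along_le[OF s, of "t + u" v "x + y"] that by (simp add: algebra_simps)
    also have "\<dots> \<le> s (x + t *\<^sub>R v) + s (y + u *\<^sub>R v) - (t + u) * s v"
      using sublinear_add[OF s] by simp
    finally show ?thesis by (simp add: algebra_simps)
  qed
  then have "sublinear_along s v (x + y) - (s (x + t *\<^sub>R v) - t * s v) \<le> sublinear_along s v y"
    if "0 \<le> t" for t
    using that by (intro sublinear_along_greatest) auto
  then have "sublinear_along s v (x + y) - sublinear_along s v y \<le> sublinear_along s v x"
    by (intro sublinear_along_greatest) (simp add: algebra_simps)
  then show "sublinear_along s v (x + y) \<le> sublinear_along s v x + sublinear_along s v y"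
    by simp
next
  fix r :: real and x assume r: "0 < r"
  have "sublinear_along s v (r *\<^sub>R x) / r \<le> sublinear_along s v x"
  proof (rule sublinear_along_greatest)
    fix t :: real assume t: "0 \<le> t"
    have "sublinear_along s v (r *\<^sub>R x) \<le> s (r *\<^sub>R (x + t *\<^sub>R v)) - r * t * s v"
      using sublinear_along_le[OF s, of "r * t" v "r *\<^sub>R x"] t r by (simp add: algebra_simps)
    also have "\<dots> = r * (s (x + t *\<^sub>R v) - t * s v)"
      using sublinear_scaleR[OF s, of r "x + t *\<^sub>R v"] r by (simp add: right_diff_distrib)
    finally show "sublinear_along s v (r *\<^sub>R x) / r \<le> s (x + t *\<^sub>R v) - t * s v"
      using r by (simp add: field_simps)
  qed
  then show "sublinear_along s v (r *\<^sub>R x) \<le> r * sublinear_along s v x"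
    using r by (simp add: field_simps)
qed

text \<open>
  Replacing \<open>s\<close> by \<open>sublinear_along s v\<close> makes it smaller, so a minimal \<open>s\<close> is unchanged, and this
  forces \<open>s (- v) \<le> - s v\<close>. A sublinear functional that is odd is additive.
\<close>

lemma minimal_sublinear_imp_linear:
  assumes s: "sublinear s"
    and min: "\<And>s'. sublinear s' \<Longrightarrow> s' \<le> s \<Longrightarrow> s' = s"
  shows "linear s"
proof -
  have minus: "s (- v) = - s v" for v
  proof -
    have "sublinear_along s v = s"
      by (intro min sublinear_sublinear_along s le_funI sublinear_along_le_self)
    then have "s (- v) \<le> - s v"
      using sublinear_along_minus[OF s, of v] by simp
    with sublinear_minus_le[OF s, of "v"] show ?thesis by simp
  qed
  show ?thesis
  proof (rule linearI)
    fix x y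
    show "s (x + y) = s x + s y"
      using sublinear_add[OF s, of x y] sublinear_add[OF s, of "x + y" "- y"] minus[of y] by simp
  next
    fix r :: real and x
    show "s (r *\<^sub>R x) = r *\<^sub>R s x"
      using sublinear_scaleR[OF s, of r x] sublinear_scaleR[OF s, of "- r" x] minus[of "r *\<^sub>R x"]
      by (cases "0 \<le> r") simp_all
  qed
qed

lemma chain_of_sublinear_has_lower_bound:
  assumes sub: "\<And>s'. s' \<in> C \<Longrightarrow> sublinear s' \<and> s' \<le> s" and ne: "C \<noteq> {}"
    and chain: "\<And>a b. a \<in> C \<Longrightarrow> b \<in> C \<Longrightarrow> a \<le> b \<or> b \<le> a"
  shows "\<exists>u. sublinear u \<and> u \<le> s \<and> (\<forall>a\<in>C. u \<le> a)"
proof -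
  define u where "u x = (INF a\<in>C. a x)" for x
  have "- s (- x) \<le> a x" if "a \<in> C" for a x
    using sublinear_minus_le[of a x] sub[OF that] le_funD[of a s "- x"] by linarith
  then have "bdd_below ((\<lambda>a. a x) ` C)" for x
    by (intro bdd_belowI2)
  then have lower: "u x \<le> a x" if "a \<in> C" for a x
    unfolding u_def using that by (intro cINF_lower)
  have greatest: "c \<le> u x" if "\<And>a. a \<in> C \<Longrightarrow> c \<le> a x" for c x
    unfolding u_def using that ne by (intro cINF_greatest)
  have "sublinear u"
    unfolding sublinear_def
  proof safe
    fix x y
    have "u (x + y) - a x \<le> b y" if ab: "a \<in> C" "b \<in> C" for a b
    proof -
      \<comment> \<open>The smaller of two members of the chain bounds \<open>u\<close> at both points.\<close>
      obtain m where m: "m \<in> C" "m \<le> a" "m \<le> b"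
        using chain[OF ab] ab by auto
      have "u (x + y) \<le> m x + m y"
        using lower[OF m(1), of "x + y"] sublinear_add[of m x y] sub[OF m(1)] by linarith
      also have "\<dots> \<le> a x + b y"
        using m by (intro add_mono) (auto dest: le_funD)
      finally show ?thesis by simp
    qed
    then have "u (x + y) - a x \<le> u y" if "a \<in> C" for a
      using that by (intro greatest)
    then have "u (x + y) - u y \<le> u x"
      by (intro greatest) (simp add: algebra_simps)
    then show "u (x + y) \<le> u x + u y" by simp
  next
    fix t :: real and x assume t: "0 < t"
    have "u (t *\<^sub>R x) / t \<le> u x"
    proof (rule greatest)
      fix a assume a: "a \<in> C"
      then have "u (t *\<^sub>R x) \<le> t * a x"
        using lower[OF a, of "t *\<^sub>R x"] sublinear_scaleR_le[of a t x] sub[OF a] t by linarith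
      then show "u (t *\<^sub>R x) / t \<le> a x" using t by (simp add: field_simps)
    qed
    then show "u (t *\<^sub>R x) \<le> t * u x" using t by (simp add: field_simps)
  qed
  moreover obtain a where "a \<in> C" using ne by auto
  then have "u \<le> s" using lower sub by (meson le_funI order_trans)
  ultimately show ?thesis using lower by (auto intro!: exI[of _ u] le_funI)
qed

text \<open>
  The Hahn-Banach theorem in the form of Zorn's lemma applied to the sublinear minorants of \<open>s\<close>: the
  pointwise infimum of a chain of them is again one, and a minimal one is linear.
\<close>

lemma sublinear_dominates_linear:
  assumes s: "sublinear s"
  shows "\<exists>l. linear l \<and> l \<le> s"
proof -
  define S where "S = {u. sublinear u \<and> u \<le> s}"
  have "\<exists>m\<in>S. \<forall>a\<in>S. a \<le> m \<longrightarrow> a = m"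
  proof (rule predicate_Zorn[where P = "\<lambda>a b. b \<le> a"])
    show "partial_order_on S (relation_of (\<lambda>a b. b \<le> a) S)"
      by (rule partial_order_on_relation_ofI) auto
  next
    fix C assume C: "C \<in> Chains (relation_of (\<lambda>a b. b \<le> a) S)"
    show "\<exists>u\<in>S. \<forall>a\<in>C. u \<le> a"
    proof (cases "C = {}")
      case True
      then show ?thesis using s by (auto simp: S_def)
    next
      case False
      have "\<exists>u. sublinear u \<and> u \<le> s \<and> (\<forall>a\<in>C. u \<le> a)"
      proof (rule chain_of_sublinear_has_lower_bound[OF _ False])
        show "sublinear s' \<and> s' \<le> s" if "s' \<in> C" for s'
          using Chains_relation_of[OF C] that by (auto simp: S_def)
        show "a \<le> b \<or> b \<le> a" if "a \<in> C" "b \<in> C" for a b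
          using C that unfolding Chains_def relation_of_def by auto
      qed
      then show ?thesis by (auto simp: S_def)
    qed
  qed
  then obtain m where m: "sublinear m" "m \<le> s" and "\<And>a. sublinear a \<Longrightarrow> a \<le> s \<Longrightarrow> a \<le> m \<Longrightarrow> a = m"
    by (auto simp: S_def)
  then have "linear m"
    by (intro minimal_sublinear_imp_linear) (auto intro: order_trans)
  with m show ?thesis by blast
qed

text \<open>
  Any linear minorant of \<open>sublinear_along s v\<close> touches \<open>s\<close> at \<open>v\<close>.
\<close>

lemma sublinear_supporting_linear:
  assumes s: "sublinear s"
  obtains l where "linear l" "\<And>x. l x \<le> s x" "l v = s v"
proof -
  obtain l where l: "linear l" "l \<le> sublinear_along s v"
    using sublinear_dominates_linear[OF sublinear_sublinear_along[OF s]] by blast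
  have le: "l x \<le> s x" for x
    using le_funD[OF l(2)] sublinear_along_le_self[OF s] by (rule order_trans)
  have "l (- v) \<le> - s v"
    using le_funD[OF l(2)] sublinear_along_minus[OF s] by (rule order_trans)
  then have "s v \<le> l v" using linear_neg[OF l(1)] by simp
  with le[of v] show ?thesis using that[OF l(1) le] by simp
qed


section \<open>The Clarke subdifferential and the mean value inequality\<close>

lemma clarke_derivative_less_imp_eventually:
  assumes "clarke_derivative g x v < ereal c"
  shows "\<forall>\<^sub>F (y, t) in nhds x \<times>\<^sub>F at_right 0. (g (y + t *\<^sub>R v) - g y) / t < c"
  using Limsup_lessD[OF assms[unfolded clarke_derivative_def]]
  by eventually_elim auto

lemma clarke_derivative_le:
  assumes "\<forall>\<^sub>F (y, t) in nhds x \<times>\<^sub>F at_right 0. (g (y + t *\<^sub>R v) - g y) / t \<le> c"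
  shows "clarke_derivative g x v \<le> ereal c"
  unfolding clarke_derivative_def
  by (rule Limsup_bounded) (use assms in \<open>eventually_elim, auto\<close>)

lemma filterlim_move_base:
  fixes x v :: "'a::real_normed_vector"
  shows "filterlim (\<lambda>(y, t). (y + t *\<^sub>R v, t)) (nhds x \<times>\<^sub>F at_right 0) (nhds x \<times>\<^sub>F at_right (0::real))"
proof -
  have "((\<lambda>z. fst z + snd z *\<^sub>R v) \<longlongrightarrow> x + 0 *\<^sub>R v) (nhds x \<times>\<^sub>F at_right (0::real))"
  proof (intro tendsto_intros filterlim_fst)
    show "(snd \<longlongrightarrow> 0) (nhds x \<times>\<^sub>F at_right (0::real))"
      by (rule filterlim_mono[OF filterlim_snd _ order_refl]) (simp add: at_within_def)
  qed
  then show ?thesis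
    by (auto simp: case_prod_unfold intro!: filterlim_Pair filterlim_snd)
qed

lemma filterlim_rescale_step:
  assumes "(0::real) < s"
  shows "filterlim (\<lambda>(y, t). (y, s * t)) (nhds x \<times>\<^sub>F at_right 0) (nhds x \<times>\<^sub>F at_right 0)"
proof -
  have "filterlim (\<lambda>t. s * t) (at_right 0) (at_right 0)"
    using filterlim_times_pos[of "\<lambda>t. t" 0 "at_right 0" s "0::real"] assms
    by (simp add: filterlim_ident)
  then have "filterlim (\<lambda>z. s * snd z) (at_right 0) (nhds x \<times>\<^sub>F at_right (0::real))"
    by (rule filterlim_compose[OF _ filterlim_snd])
  then show ?thesis
    by (auto simp: case_prod_unfold intro!: filterlim_Pair filterlim_fst)
qed

lemma eventually_at_right_pos_snd: "\<forall>\<^sub>F z in nhds x \<times>\<^sub>F at_right (0::real). 0 < snd z"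
  by (rule eventually_compose_filterlim[OF _ filterlim_snd]) (simp add: eventually_at_right_less)

text \<open>
  The Lipschitz bound confines the difference quotients to \<open>[- L * norm v, L * norm v]\<close>, which makes
  the Clarke derivative a real number.
\<close>

lemma clarke_derivative_lipschitz:
  fixes g :: "'a::real_normed_vector \<Rightarrow> real"
  assumes "lipschitz_on_balls g"
  obtains L where "0 \<le> L" "\<And>v. \<bar>clarke_derivative g x v\<bar> \<le> ereal (L * norm v)"
proof -
  obtain L where L: "L-lipschitz_on (ball x 1) g"
    using assms unfolding lipschitz_on_balls_def by blast
  have "\<bar>clarke_derivative g x v\<bar> \<le> ereal (L * norm v)" for v
  proof -
    have near: "\<forall>\<^sub>F y in nhds x. y \<in> ball x 1"
      by (intro eventually_nhds_in_open) auto
    have "\<forall>\<^sub>F z in nhds x \<times>\<^sub>F at_right (0::real). fst z \<in> ball x 1"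
      by (rule eventually_compose_filterlim[OF near filterlim_fst])
    moreover have "\<forall>\<^sub>F z in nhds x \<times>\<^sub>F at_right (0::real). fst (case z of (y, t) \<Rightarrow> (y + t *\<^sub>R v, t)) \<in> ball x 1"
      by (rule eventually_compose_filterlim[OF near filterlim_compose[OF filterlim_fst filterlim_move_base]])
    ultimately have ev: "\<forall>\<^sub>F (y, t) in nhds x \<times>\<^sub>F at_right 0. \<bar>(g (y + t *\<^sub>R v) - g y) / t\<bar> \<le> L * norm v"
      using eventually_at_right_pos_snd[of x]
    proof eventually_elim
      case (elim z)
      obtain y t where z: "z = (y, t)" by fastforce
      with elim have "dist (g (y + t *\<^sub>R v)) (g y) \<le> L * dist (y + t *\<^sub>R v) y" "0 < t"
        by (auto intro: lipschitz_onD[OF L])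
      then show ?case by (simp add: z dist_norm field_simps)
    qed
    have "clarke_derivative g x v \<le> ereal (L * norm v)"
      by (rule clarke_derivative_le) (use ev in \<open>auto elim!: eventually_mono simp: abs_le_iff simp del: abs_divide\<close>)
    moreover have "ereal (- (L * norm v)) \<le> clarke_derivative g x v"
      unfolding clarke_derivative_def
      by (rule le_Limsup) (use ev in \<open>auto simp: prod_filter_eq_bot abs_le_iff simp del: abs_divide elim!: eventually_mono\<close>)
    ultimately show ?thesis by (cases "clarke_derivative g x v") (auto simp: abs_le_iff)
  qed
  moreover have "0 \<le> L" using L lipschitz_on_nonneg by blast
  ultimately show ?thesis using that by blast
qed

text \<open>
  In contrast with the one-sided directional derivative, the base point of the difference quotients
  is free to move. That is what makes the limit superior subadditive for a nonconvex \<open>g\<close>.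
\<close>

lemma sublinear_clarke_derivative:
  fixes g :: "'a::real_normed_vector \<Rightarrow> real"
  assumes fin: "\<And>v. clarke_derivative g x v = ereal (d v)"
  shows "sublinear d"
proof -
  have less: "\<forall>\<^sub>F (y, t) in nhds x \<times>\<^sub>F at_right 0. (g (y + t *\<^sub>R v) - g y) / t < d v + e"
    if "0 < e" for v e
    using that by (intro clarke_derivative_less_imp_eventually) (simp add: fin)
  have le: "d v \<le> c" if "\<forall>\<^sub>F (y, t) in nhds x \<times>\<^sub>F at_right 0. (g (y + t *\<^sub>R v) - g y) / t \<le> c" for v c
    using clarke_derivative_le[OF that] by (simp add: fin)
  show ?thesis
    unfolding sublinear_def
  proof safe
    fix v w
    show "d (v + w) \<le> d v + d w"
    proof (rule field_le_epsilon)
      fix e :: real assume e: "0 < e"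
      \<comment> \<open>The increment along \<open>v + w\<close> is the one along \<open>v\<close> followed by the one along \<open>w\<close> from \<open>y + t *\<^sub>R v\<close>.\<close>
      have "\<forall>\<^sub>F (y, t) in nhds x \<times>\<^sub>F at_right 0. (g (y + t *\<^sub>R (v + w)) - g y) / t \<le> d v + d w + e"
        using less[of "e/2" v, OF half_gt_zero[OF e]]
          eventually_compose_filterlim[OF less[of "e/2" w, OF half_gt_zero[OF e]] filterlim_move_base[of v]]
      proof eventually_elim
        case (elim z)
        obtain y t where z: "z = (y, t)" by fastforce
        from elim show ?case
          by (simp add: z scaleR_add_right add.assoc diff_divide_distrib)
      qed
      then show "d (v + w) \<le> d v + d w + e" by (rule le)
    qed
  next
    fix s :: real and v assume s: "0 < s"
    have "d (s *\<^sub>R v) / s \<le> d v"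
    proof (rule field_le_epsilon)
      fix e :: real assume e: "0 < e"
      have "\<forall>\<^sub>F (y, t) in nhds x \<times>\<^sub>F at_right 0. (g (y + t *\<^sub>R s *\<^sub>R v) - g y) / t \<le> s * (d v + e)"
        using eventually_compose_filterlim[OF less[OF e, of v] filterlim_rescale_step[OF s]]
      proof eventually_elim
        case (elim z)
        obtain y t where z: "z = (y, t)" by fastforce
        from elim have "(g (y + (s * t) *\<^sub>R v) - g y) / (s * t) < d v + e"
          by (simp add: z)
        then have "s * ((g (y + (s * t) *\<^sub>R v) - g y) / (s * t)) \<le> s * (d v + e)"
          using s by (intro mult_left_mono) auto
        moreover have "s * ((g (y + (s * t) *\<^sub>R v) - g y) / (s * t)) = (g (y + (s * t) *\<^sub>R v) - g y) / t"
          using s by simp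
        ultimately show ?case by (simp add: z mult.commute)
      qed
      then have "d (s *\<^sub>R v) \<le> s * (d v + e)" by (rule le)
      then show "d (s *\<^sub>R v) / s \<le> d v + e" using s by (simp add: field_simps)
    qed
    then show "d (s *\<^sub>R v) \<le> s * d v" using s by (simp add: field_simps)
  qed
qed

text \<open>
  The Clarke derivative is the support function of the Clarke subdifferential, and the supremum is a
  maximum. In particular a bound on the norms of the subgradients at \<open>x\<close> bounds the derivative there.
\<close>

lemma clarke_derivative_attained:
  fixes g :: "'a::real_normed_vector \<Rightarrow> real"
  assumes "lipschitz_on_balls g"
  obtains l where "l \<in> clarke_subdifferential g x" "clarke_derivative g x v = ereal (blinfun_apply l v)"
proof -
  obtain L where L: "0 \<le> L" "\<And>v. \<bar>clarke_derivative g x v\<bar> \<le> ereal (L * norm v)"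
    using clarke_derivative_lipschitz[OF assms] by blast
  define d where "d v = real_of_ereal (clarke_derivative g x v)" for v
  have fin: "clarke_derivative g x v = ereal (d v)" for v
    using L(2)[of v] unfolding d_def by (cases "clarke_derivative g x v") auto
  have d: "d v \<le> L * norm v" for v
    using L(2)[of v] by (simp add: fin)
  obtain l where l: "linear l" "\<And>w. l w \<le> d w" "l v = d v"
    using sublinear_supporting_linear[OF sublinear_clarke_derivative[OF fin]] by blast
  have "\<bar>l w\<bar> \<le> norm w * L" for w
    using l(2)[of w] d[of w] l(2)[of "- w"] d[of "- w"] linear_neg[OF l(1), of w]
    by (simp add: mult.commute abs_le_iff)
  then have "bounded_linear l"
    using l(1) by (intro bounded_linear.intro) (auto simp: bounded_linear_axioms_def)
  then have "blinfun_apply (Blinfun l) = l" by (rule bounded_linear_Blinfun_apply)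
  then show ?thesis
    using that[of "Blinfun l"] l by (auto simp: clarke_subdifferential_def fin)
qed

text \<open>
  The mean value inequality that follows from Lebourg's theorem. If \<open>c\<close> exceeds \<open>K * norm (b - a)\<close>,
  then at every point of the segment the Clarke derivative along \<open>b - a\<close> is less than \<open>c\<close>. Its limit
  superior runs over all base points near by, so the increments of \<open>g\<close> over short pieces of the segment
  around that point are at most \<open>c\<close> times the length of the parameter interval. Bisection patches the
  pieces together.
\<close>

lemma clarke_mean_value_inequality:
  fixes g :: "'a::real_normed_vector \<Rightarrow> real"
  assumes lip: "lipschitz_on_balls g"
    and K: "\<And>z l. z \<in> closed_segment a b \<Longrightarrow> l \<in> clarke_subdifferential g z \<Longrightarrow> norm l \<le> K"
  shows "g b - g a \<le> K * norm (b - a)"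
proof (rule field_le_epsilon)
  fix e :: real assume e: "0 < e"
  define v where "v = b - a"
  define c where "c = K * norm v + e"
  define z where "z t = a + t *\<^sub>R v" for t
  have "g (z 1) - g (z 0) \<le> c * (1 - 0)"
  proof (rule Bolzano[of 0 1 "\<lambda>s t. g (z t) - g (z s) \<le> c * (t - s)"])
    fix x :: real assume x: "0 \<le> x" "x \<le> 1"
    have seg: "z x \<in> closed_segment a b"
      using x unfolding z_def v_def closed_segment_def by (auto simp: algebra_simps intro!: exI[of _ x])
    obtain l where l: "l \<in> clarke_subdifferential g (z x)" "clarke_derivative g (z x) v = ereal (blinfun_apply l v)"
      using clarke_derivative_attained[OF lip] by blast
    have "blinfun_apply l v \<le> norm l * norm v" using norm_blinfun[of l v] by simp
    also have "\<dots> \<le> K * norm v" using K[OF seg l(1)] by (intro mult_right_mono) auto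
    finally have "clarke_derivative g (z x) v < ereal c" using e by (simp add: l(2) c_def)
    from clarke_derivative_less_imp_eventually[OF this]
    obtain P Q where P: "eventually P (nhds (z x))" and Q: "eventually Q (at_right 0)"
      and PQ: "\<And>y t. P y \<Longrightarrow> Q t \<Longrightarrow> (g (y + t *\<^sub>R v) - g y) / t < c"
      by (auto simp: eventually_prod_filter)
    obtain d1 where d1: "0 < d1" "\<And>y. dist y (z x) < d1 \<Longrightarrow> P y"
      using P by (auto simp: eventually_nhds_metric)
    obtain d2 where d2: "0 < d2" "\<And>t. 0 < t \<Longrightarrow> t < d2 \<Longrightarrow> Q t"
      using Q by (auto simp: eventually_at_right_field)
    \<comment> \<open>The \<open>1\<close> covers the case \<open>v = 0\<close>.\<close>
    define d where "d = min d2 (d1 / (norm v + 1))"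
    have "g (z t) - g (z s) \<le> c * (t - s)" if st: "s \<le> x \<and> x \<le> t \<and> t - s < d" for s t
    proof (cases "s = t")
      case False
      with st have h: "0 < t - s" "t - s < d2" "(t - s) * (norm v + 1) < d1"
        by (auto simp: d_def pos_less_divide_eq add_nonneg_pos)
      have "dist (z s) (z x) = (x - s) * norm v"
        using st by (simp add: z_def dist_norm flip: scaleR_left_diff_distrib)
      also have "\<dots> \<le> (t - s) * (norm v + 1)" using st by (intro mult_mono) auto
      finally have "P (z s)" using h by (intro d1) simp
      then have "(g (z s + (t - s) *\<^sub>R v) - g (z s)) / (t - s) < c"
        using d2 h by (intro PQ) auto
      moreover have "z s + (t - s) *\<^sub>R v = z t" by (simp add: z_def algebra_simps)
      ultimately show ?thesis using h by (simp add: field_simps)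
    qed simp
    moreover have "0 < d" using d1 d2 by (simp add: d_def add_nonneg_pos)
    ultimately show "\<exists>d>0. \<forall>s t. s \<le> x \<and> x \<le> t \<and> t - s < d \<longrightarrow> g (z t) - g (z s) \<le> c * (t - s)"
      by blast
  qed (auto simp: algebra_simps)
  then show "g b - g a \<le> K * norm (b - a) + e"
    by (simp add: z_def v_def c_def)
qed


section \<open>A criterion for uniform integrability\<close>

text \<open>
  The bounded part is \<open>min (H w) n\<close> on the set where \<open>H w \<ge> 1 / (n + 1)\<close>, which has finite measure by
  Markov's inequality; by dominated convergence these truncations exhaust the integral of \<open>H\<close>. In this
  way both requirements of uniform integrability for the single function \<open>H\<close> reduce to those for a
  multiple of an indicator function, where they are evident.
\<close>

lemma integrable_decompose_bounded:
  fixes H :: "'w \<Rightarrow> real"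
  assumes H: "integrable M H" and nonneg: "\<And>w. 0 \<le> H w" and e: "0 < e"
  obtains k K G where "0 < k" "K \<in> sets M" "emeasure M K < \<infinity>"
    "integrable M G" "\<And>w. 0 \<le> G w" "(LINT w|M. G w) \<le> e"
    "\<And>w. w \<in> space M \<Longrightarrow> H w \<le> k * indicator K w + G w"
proof -
  define K where "K n = {w \<in> space M. 1 \<le> real (Suc n) * H w}" for n
  define T where "T n w = min (H w) (real n) * indicator (K n) w" for n w
  have [measurable]: "H \<in> borel_measurable M" using H by simp
  have K [measurable]: "K n \<in> sets M" for n unfolding K_def by measurable
  have lim: "(\<lambda>n. T n w) \<longlonglongrightarrow> H w" if w: "w \<in> space M" for w
  proof (cases "H w = 0")
    case True
    then show ?thesis by (simp add: T_def)
  next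
    case False
    then have pos: "0 < H w" using nonneg[of w] by simp
    obtain N :: nat where N: "max (H w) (1 / H w) < real N" using reals_Archimedean2 by blast
    have "T n w = H w" if n: "N \<le> n" for n
    proof -
      have "max (H w) (1 / H w) < real n" using N n by simp
      moreover from this have "1 \<le> real (Suc n) * H w"
        using pos by (auto simp: pos_divide_less_eq algebra_simps)
      ultimately show ?thesis using w by (simp add: T_def K_def)
    qed
    then have "\<forall>\<^sub>F n in sequentially. T n w = H w" by (auto simp: eventually_sequentially)
    then show ?thesis by (rule tendsto_eventually)
  qed
  have bound: "norm (T n w) \<le> H w" for n w
    using nonneg[of w] by (auto simp: T_def indicator_def)
  have T: "integrable M (T n)" for n
  proof (rule Bochner_Integration.integrable_bound[OF H])
    show "T n \<in> borel_measurable M" unfolding T_def by measurable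
    show "AE w in M. norm (T n w) \<le> norm (H w)" using bound nonneg by (intro AE_I2) simp
  qed
  have "(\<lambda>n. LINT w|M. T n w) \<longlonglongrightarrow> (LINT w|M. H w)"
    by (rule integral_dominated_convergence[where w = H]) (use H T lim bound in \<open>auto intro!: AE_I2\<close>)
  then obtain N where N: "\<bar>(LINT w|M. T N w) - (LINT w|M. H w)\<bar> < e"
    using e unfolding LIMSEQ_iff by (metis order_refl real_norm_def)
  show ?thesis
  proof
    show "0 < real (Suc N)" "K N \<in> sets M" by simp_all
    have "emeasure M (K N) \<le> ennreal (real (Suc N)) * (\<integral>\<^sup>+ w. ennreal (H w) * indicator (space M) w \<partial>M)"
      using nn_integral_Markov_inequality[of "\<lambda>w. ennreal (H w)" "space M" M "ennreal (real (Suc N))"]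
        nonneg by (simp add: K_def flip: ennreal_mult del: of_nat_Suc)
    also have "(\<integral>\<^sup>+ w. ennreal (H w) * indicator (space M) w \<partial>M) = (\<integral>\<^sup>+ w. ennreal (H w) \<partial>M)"
      by (intro nn_integral_cong) simp
    also have "\<dots> = ennreal (LINT w|M. H w)"
      using H nonneg by (intro nn_integral_eq_integral) auto
    finally show "emeasure M (K N) < \<infinity>"
      by (simp add: ennreal_mult_less_top le_less_trans del: of_nat_Suc)
    show "integrable M (\<lambda>w. H w - T N w)" using H T by simp
    show "0 \<le> H w - T N w" for w using bound[of N w] by (simp add: abs_le_iff)
    show "(LINT w|M. H w - T N w) \<le> e" using H T N by simp
    show "H w \<le> real (Suc N) * indicator (K N) w + (H w - T N w)" for w
      by (auto simp: T_def indicator_def)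
  qed
qed

lemma nn_integral_real_eq:
  fixes g :: "'w \<Rightarrow> real"
  assumes "integrable M g" "\<And>w. 0 \<le> g w"
  shows "(\<integral>\<^sup>+ w. ennreal (g w) \<partial>M) = ennreal (LINT w|M. g w)"
  using assms by (intro nn_integral_eq_integral) auto

text \<open>
  Uniform integrability is insensitive to perturbations that are small in the \<open>L\<^sub>1\<close>-norm, so it is
  enough to dominate the sequence by a single integrable function up to an arbitrarily small error.
  The error needs to be small only eventually, because finitely many integrable functions are always
  uniformly integrable.
\<close>

lemma uniformly_integrable_rangeI:
  fixes u :: "nat \<Rightarrow> 'w \<Rightarrow> real"
  assumes u: "\<And>n. integrable M (u n)"
    and dom: "\<And>e. 0 < e \<Longrightarrow> \<exists>H g. integrable M H \<and> (\<forall>w. 0 \<le> H w) \<and>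
      (\<forall>n. integrable M (g n) \<and> (\<forall>w. 0 \<le> g n w) \<and> (AE w in M. \<bar>u n w\<bar> \<le> H w + g n w)) \<and>
      (\<forall>\<^sub>F n in sequentially. (LINT w|M. g n w) \<le> e)"
  shows "uniformly_integrable M (range u)"
proof -
  have dom': "\<exists>H g. integrable M H \<and> (\<forall>w. 0 \<le> H w) \<and>
      (\<forall>n. integrable M (g n) \<and> (\<forall>w. 0 \<le> g n w) \<and> (LINT w|M. g n w) \<le> e \<and>
        (AE w in M. \<bar>u n w\<bar> \<le> H w + g n w))" if e: "0 < e" for e
  proof -
    obtain H g where H: "integrable M H" "\<And>w. 0 \<le> H w"
      and g: "\<And>n. integrable M (g n)" "\<And>n w. 0 \<le> g n w" "\<And>n. AE w in M. \<bar>u n w\<bar> \<le> H w + g n w"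
      and ev: "\<forall>\<^sub>F n in sequentially. (LINT w|M. g n w) \<le> e"
      using dom[OF e] by blast
    then obtain N where small: "\<And>n. N \<le> n \<Longrightarrow> (LINT w|M. g n w) \<le> e"
      unfolding eventually_sequentially by blast
    \<comment> \<open>The finitely many early terms are integrable, so they can be absorbed into the dominating function.\<close>
    define H' where "H' w = H w + (\<Sum>n<N. \<bar>u n w\<bar>)" for w
    define g' where "g' n = (if N \<le> n then g n else (\<lambda>_. 0))" for n
    have "\<bar>u n w\<bar> \<le> H' w + g' n w" if "\<bar>u n w\<bar> \<le> H w + g n w" for n w
    proof (cases "N \<le> n")
      case True
      have "0 \<le> (\<Sum>n<N. \<bar>u n w\<bar>)" by (intro sum_nonneg) auto
      moreover have "g' n w = g n w" using True by (simp add: g'_def)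
      ultimately show ?thesis using that unfolding H'_def by linarith
    next
      case False
      then show ?thesis
        using member_le_sum[of n "{..<N}" "\<lambda>n. \<bar>u n w\<bar>"] H(2)[of w] by (simp add: H'_def g'_def)
    qed
    then have "AE w in M. \<bar>u n w\<bar> \<le> H' w + g' n w" for n
      using g(3)[of n] by (auto elim: eventually_mono)
    moreover have "integrable M H'"
      unfolding H'_def using H(1) u by simp
    moreover have "0 \<le> H' w" for w
      using H(2)[of w] by (simp add: H'_def sum_nonneg)
    moreover have "integrable M (g' n)" "0 \<le> g' n w" "(LINT w|M. g' n w) \<le> e" for n w
      using g(1,2) small e by (simp_all add: g'_def)
    ultimately show ?thesis by (intro exI[of _ H'] exI[of _ g']) simp
  qed
  have bounded: "\<exists>C. \<forall>v\<in>range u. (LINT w|M. \<bar>v w\<bar>) \<le> C"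
  proof -
    obtain H g where H: "integrable M H" "\<And>w. 0 \<le> H w"
      and g: "\<And>n. integrable M (g n)" "\<And>n. (LINT w|M. g n w) \<le> 1" "\<And>n. AE w in M. \<bar>u n w\<bar> \<le> H w + g n w"
      using dom'[OF zero_less_one] by blast
    have "(LINT w|M. \<bar>u n w\<bar>) \<le> (LINT w|M. H w) + 1" for n
    proof -
      have "(LINT w|M. \<bar>u n w\<bar>) \<le> (LINT w|M. H w + g n w)"
        using g H u by (intro integral_mono_AE) auto
      also have "\<dots> \<le> (LINT w|M. H w) + 1" using g H by simp
      finally show ?thesis .
    qed
    then show ?thesis by auto
  qed
  have small: "\<exists>\<eta>::real. \<exists>K. \<eta> > 0 \<and> K \<in> sets M \<and> emeasure M K < \<infinity> \<and>
      (\<forall>A\<in>sets M. emeasure M A \<le> ennreal \<eta> \<longrightarrow>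
         (SUP v\<in>range u. \<integral>\<^sup>+ w. ennreal \<bar>v w * indicator A w\<bar> \<partial>M) < ennreal \<epsilon>) \<and>
      (SUP v\<in>range u. \<integral>\<^sup>+ w. ennreal \<bar>v w * indicator (space M - K) w\<bar> \<partial>M) < ennreal \<epsilon>"
    if e: "0 < \<epsilon>" for \<epsilon> :: real
  proof -
    \<comment> \<open>Three errors of size \<open>\<delta>\<close> have to add up to strictly less than \<open>\<epsilon>\<close>.\<close>
    define \<delta> where "\<delta> = \<epsilon> / 4"
    have \<delta>: "0 < \<delta>" using e by (simp add: \<delta>_def)
    obtain H g where H: "integrable M H" "\<And>w. 0 \<le> H w"
      and g: "\<And>n. integrable M (g n)" "\<And>n w. 0 \<le> g n w" "\<And>n. (LINT w|M. g n w) \<le> \<delta>"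
        "\<And>n. AE w in M. \<bar>u n w\<bar> \<le> H w + g n w"
      using dom'[OF \<delta>] by blast
    obtain k K G where k: "0 < k" and K [measurable]: "K \<in> sets M" "emeasure M K < \<infinity>"
      and G: "integrable M G" "\<And>w. 0 \<le> G w" "(LINT w|M. G w) \<le> \<delta>"
      and HG: "\<And>w. w \<in> space M \<Longrightarrow> H w \<le> k * indicator K w + G w"
      using integrable_decompose_bounded[OF H \<delta>] by blast
    have main: "(\<integral>\<^sup>+ w. ennreal \<bar>u n w * indicator A w\<bar> \<partial>M) \<le> ennreal k * emeasure M (K \<inter> A) + ennreal (2 * \<delta>)"
      if A [measurable]: "A \<in> sets M" for A n
    proof -
      have [measurable]: "G \<in> borel_measurable M" "g n \<in> borel_measurable M" using G g by auto
      have "(\<integral>\<^sup>+ w. ennreal \<bar>u n w * indicator A w\<bar> \<partial>M)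
          \<le> (\<integral>\<^sup>+ w. ennreal k * indicator (K \<inter> A) w + (ennreal (G w) + ennreal (g n w)) \<partial>M)"
      proof (rule nn_integral_mono_AE)
        show "AE w in M. ennreal \<bar>u n w * indicator A w\<bar>
            \<le> ennreal k * indicator (K \<inter> A) w + (ennreal (G w) + ennreal (g n w))"
          using g(4)[of n] AE_space
        proof eventually_elim
          case (elim w)
          have "\<bar>u n w * indicator A w\<bar> \<le> k * indicator (K \<inter> A) w + (G w + g n w)"
            using elim HG[of w] G(2)[of w] g(2)[of n w] k by (auto simp: indicator_def split: if_splits)
          then have "ennreal \<bar>u n w * indicator A w\<bar> \<le> ennreal (k * indicator (K \<inter> A) w + (G w + g n w))"
            by (rule ennreal_leI)
          also have "\<dots> = ennreal k * indicator (K \<inter> A) w + (ennreal (G w) + ennreal (g n w))"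
            using k G(2)[of w] g(2)[of n w] by (simp add: ennreal_mult ennreal_indicator)
          finally show ?case .
        qed
      qed
      also have "\<dots> = ennreal k * emeasure M (K \<inter> A) + (ennreal (LINT w|M. G w) + ennreal (LINT w|M. g n w))"
        using G g by (simp add: nn_integral_add nn_integral_cmult nn_integral_real_eq)
      also have "ennreal (LINT w|M. G w) + ennreal (LINT w|M. g n w) \<le> ennreal (2 * \<delta>)"
      proof -
        have "0 \<le> (LINT w|M. G w)" "0 \<le> (LINT w|M. g n w)"
          using G(2) g(2) by simp_all
        then have "ennreal (LINT w|M. G w) + ennreal (LINT w|M. g n w)
            = ennreal ((LINT w|M. G w) + (LINT w|M. g n w))"
          by (rule ennreal_plus[symmetric])
        also have "\<dots> \<le> ennreal (2 * \<delta>)"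
          using G(3) g(3)[of n] by (intro ennreal_leI) simp
        finally show ?thesis .
      qed
      finally show ?thesis by (simp add: add_left_mono)
    qed
    define \<eta> where "\<eta> = \<delta> / k"
    have "(SUP v\<in>range u. \<integral>\<^sup>+ w. ennreal \<bar>v w * indicator A w\<bar> \<partial>M) < ennreal \<epsilon>"
      if A: "A \<in> sets M" "ennreal k * emeasure M (K \<inter> A) \<le> ennreal \<delta>" for A
    proof -
      have "(SUP v\<in>range u. \<integral>\<^sup>+ w. ennreal \<bar>v w * indicator A w\<bar> \<partial>M) \<le> ennreal \<delta> + ennreal (2 * \<delta>)"
        using main[OF A(1)] A(2) by (auto intro!: SUP_least intro: order_trans add_right_mono)
      also have "\<dots> < ennreal \<epsilon>"
        using \<delta> e by (simp add: \<delta>_def ennreal_less_iff flip: ennreal_plus)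
      finally show ?thesis .
    qed
    note * = this
    have "ennreal k * emeasure M (K \<inter> A) \<le> ennreal \<delta>" if "A \<in> sets M" "emeasure M A \<le> ennreal \<eta>" for A
    proof -
      have "ennreal k * emeasure M (K \<inter> A) \<le> ennreal k * ennreal \<eta>"
        using that emeasure_mono[of "K \<inter> A" A M] by (intro mult_left_mono) (auto intro: order_trans)
      also have "\<dots> = ennreal \<delta>" using k \<delta> by (simp add: \<eta>_def flip: ennreal_mult)
      finally show ?thesis .
    qed
    moreover have "ennreal k * emeasure M (K \<inter> (space M - K)) \<le> ennreal \<delta>" by simp
    moreover have "0 < \<eta>" using k \<delta> by (simp add: \<eta>_def)
    moreover have "space M - K \<in> sets M" by simp
    ultimately show ?thesis
      using K * by (intro exI[of _ \<eta>] exI[of _ K]) simp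
  qed
  show ?thesis
    unfolding uniformly_integrable_def using u bounded small by auto
qed


section \<open>Growth of order \<open>p - 1\<close>\<close>

lemma powr_add_le:
  fixes s t r :: real
  assumes "0 \<le> s" "0 \<le> t" "0 \<le> r"
  shows "(s + t) powr r \<le> 2 powr r * (s powr r + t powr r)"
proof -
  have "(s + t) powr r \<le> (2 * max s t) powr r"
    using assms by (intro powr_mono2) auto
  also have "\<dots> = 2 powr r * max s t powr r"
    using assms by (intro powr_mult)
  also have "max s t powr r \<le> s powr r + t powr r"
    by (cases "s \<le> t") (auto simp: max_def)
  finally show ?thesis by simp
qed

lemma conjugate_exponent:
  fixes p q :: real
  assumes "1 < p" "1 / p + 1 / q = 1"
  shows "1 < q" "(p - 1) * q = p" "p / q = p - 1"
proof -
  have q: "q = p / (p - 1)"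
    using assms by (cases "q = 0") (auto simp: field_simps)
  show "1 < q" "(p - 1) * q = p" "p / q = p - 1"
    using assms(1) unfolding q by (auto simp: field_simps)
qed

lemma Lp_space_scale_add:
  fixes x y :: "'w \<Rightarrow> real"
  assumes x: "x \<in> Lp_space q M" and y: "y \<in> Lp_space q M" and q: "0 \<le> q"
    and nn: "\<And>w. 0 \<le> x w" "\<And>w. 0 \<le> y w" "0 \<le> c" "0 \<le> d"
  shows "(\<lambda>w. c * x w + d * y w) \<in> Lp_space q M"
proof -
  have [measurable]: "x \<in> borel_measurable M" "y \<in> borel_measurable M"
    using x y by (auto simp: Lp_space_def)
  have "integrable M (\<lambda>w. norm (c * x w + d * y w) powr q)"
  proof (rule Bochner_Integration.integrable_bound)
    show "integrable M (\<lambda>w. 2 powr q * (c powr q * norm (x w) powr q + d powr q * norm (y w) powr q))"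
      using x y unfolding Lp_space_def by (intro integrable_mult_right Bochner_Integration.integrable_add) auto
    show "AE w in M. norm (norm (c * x w + d * y w) powr q)
        \<le> norm (2 powr q * (c powr q * norm (x w) powr q + d powr q * norm (y w) powr q))"
    proof (rule AE_I2)
      fix w
      have "(c * x w + d * y w) powr q \<le> 2 powr q * (c powr q * x w powr q + d powr q * y w powr q)"
        using powr_add_le[of "c * x w" "d * y w" q] nn q by (simp add: powr_mult)
      then show "norm (norm (c * x w + d * y w) powr q)
        \<le> norm (2 powr q * (c powr q * norm (x w) powr q + d powr q * norm (y w) powr q))"
        using nn by simp
    qed
  qed measurable
  then show ?thesis by (simp add: Lp_space_def)
qed

text \<open>
  With \<open>s = p - 1\<close> and \<open>q\<close> the conjugate exponent, this puts the growth term \<open>norm (x0 w) powr (p - 1)\<close>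
  of an \<open>L\<^sub>p\<close> function into \<open>L\<^sub>q\<close>.
\<close>

lemma Lp_space_norm_powr:
  fixes x :: "'w \<Rightarrow> 'a::{real_normed_vector, second_countable_topology}"
  assumes "x \<in> Lp_space p M" "s * q = p"
  shows "(\<lambda>w. norm (x w) powr s) \<in> Lp_space q M"
  using assms by (auto simp: Lp_space_def powr_powr)

text \<open>
  One admissible \<open>k\<close> suffices. The bound at \<open>x0 w + (e - x0 w)\<close> reads
  \<open>(k * norm l) powr q \<le> X * norm (e - x0 w) powr p + q * \<bar>u w\<bar>\<close>; its \<open>q\<close>-th root has order \<open>p / q = p - 1\<close>
  in \<open>e\<close>, and the parts that depend on \<open>w\<close> alone, \<open>norm (x0 w) powr (p - 1)\<close> and \<open>\<bar>u w\<bar> powr (1 / q)\<close>, lie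
  in \<open>L\<^sub>q\<close>.
\<close>

lemma condition_S_phi_imp_condition_S:
  fixes x0 :: "'w \<Rightarrow> 'a::{real_normed_vector, second_countable_topology}"
  assumes p: "1 < p" and pq: "1 / p + 1 / q = 1" and x0: "x0 \<in> Lp_space p M"
    and S: "condition_S_phi M (power_phi p) x0 f"
  shows "condition_S M p q f"
proof -
  note q = conjugate_exponent[OF p pq]
  obtain c k0 where c: "0 < c" "0 < k0"
    and ck: "\<And>k. k0 < k \<Longrightarrow> \<exists>\<beta>>0. \<exists>u. integrable M u \<and>
        (AE w in M. \<forall>e.
           (SUP l\<in>clarke_subdifferential (f w) (x0 w + e). conjugate (power_phi p) (k *\<^sub>R l))
             \<le> ereal (c * power_phi p (\<beta> *\<^sub>R e) + u w))"
    using S unfolding condition_S_phi_def by blast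
  define k where "k = k0 + 1"
  have k: "0 < k" using c by (simp add: k_def)
  obtain \<beta> u where \<beta>: "0 < \<beta>" and u: "integrable M u"
    and bound: "AE w in M. \<forall>e. (SUP l\<in>clarke_subdifferential (f w) (x0 w + e).
        conjugate (power_phi p) (k *\<^sub>R l)) \<le> ereal (c * power_phi p (\<beta> *\<^sub>R e) + u w)"
    using ck[of k] by (auto simp: k_def)
  define X where "X = q * (c * \<beta> powr p / p)"
  define C where "C = 2 powr (1 / q) * X powr (1 / q) * 2 powr (p - 1) / k"
  define D where "D = 2 powr (1 / q) * q powr (1 / q) / k"
  have X: "0 < X" using c \<beta> p q by (simp add: X_def)
  have CD: "0 < C" "0 < D" using X k q by (simp_all add: C_def D_def)
  define a where "a w = C * norm (x0 w) powr (p - 1) + D * \<bar>u w\<bar> powr (1 / q)" for w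
  have "(\<lambda>w. \<bar>u w\<bar> powr (1 / q)) \<in> Lp_space q M"
    using Lp_space_norm_powr[of u 1 M "1 / q" q] u q by (simp add: Lp_space_def)
  then have a: "a \<in> Lp_space q M"
    unfolding a_def using CD q Lp_space_norm_powr[OF x0 q(2)]
    by (intro Lp_space_scale_add) auto
  have "norm l \<le> C * norm e powr (p - 1) + a w"
    if w: "\<forall>e. (SUP l\<in>clarke_subdifferential (f w) (x0 w + e).
        conjugate (power_phi p) (k *\<^sub>R l)) \<le> ereal (c * power_phi p (\<beta> *\<^sub>R e) + u w)"
      and l: "l \<in> clarke_subdifferential (f w) e" for w e l
  proof -
    define N where "N = norm (e - x0 w)"
    have N: "0 \<le> N" by (simp add: N_def)
    have root: "(N powr p) powr (1 / q) = N powr (p - 1)"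
      by (simp only: powr_powr times_divide_eq_right mult_1_right q(3))
    have "conjugate (power_phi p) (k *\<^sub>R l) \<le> ereal (c * power_phi p (\<beta> *\<^sub>R (e - x0 w)) + u w)"
      using w[rule_format, of "e - x0 w"] l by (simp add: SUP_le_iff)
    then have "(k * norm l) powr q / q \<le> c * ((\<beta> * N) powr p / p) + u w"
      using k \<beta> by (simp add: conjugate_power_phi[OF p pq] power_phi_def N_def)
    then have "(k * norm l) powr q \<le> q * (c * ((\<beta> * N) powr p / p) + u w)"
      using q by (simp add: pos_divide_le_eq mult.commute)
    also have "\<dots> \<le> X * N powr p + q * \<bar>u w\<bar>"
      using \<beta> N q by (simp add: X_def powr_mult distrib_left mult.assoc)
    finally have "((k * norm l) powr q) powr (1 / q) \<le> (X * N powr p + q * \<bar>u w\<bar>) powr (1 / q)"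
      using q by (intro powr_mono2) auto
    then have "k * norm l \<le> (X * N powr p + q * \<bar>u w\<bar>) powr (1 / q)"
      using k q by (simp add: powr_powr)
    also have "\<dots> \<le> 2 powr (1 / q) * ((X * N powr p) powr (1 / q) + (q * \<bar>u w\<bar>) powr (1 / q))"
      using X q by (intro powr_add_le) auto
    also have "\<dots> = 2 powr (1 / q) * X powr (1 / q) * N powr (p - 1)
        + 2 powr (1 / q) * q powr (1 / q) * \<bar>u w\<bar> powr (1 / q)"
      using X N q(1) root by (simp add: powr_mult distrib_left mult.assoc)
    also have "N powr (p - 1) \<le> (norm e + norm (x0 w)) powr (p - 1)"
      unfolding N_def using p by (intro powr_mono2 norm_triangle_ineq4) auto
    also have "\<dots> \<le> 2 powr (p - 1) * (norm e powr (p - 1) + norm (x0 w) powr (p - 1))"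
      using p by (intro powr_add_le) auto
    finally have "k * norm l \<le> 2 powr (1 / q) * X powr (1 / q) *
        (2 powr (p - 1) * (norm e powr (p - 1) + norm (x0 w) powr (p - 1)))
        + 2 powr (1 / q) * q powr (1 / q) * \<bar>u w\<bar> powr (1 / q)"
      using X by simp
    then have "norm l \<le> (2 powr (1 / q) * X powr (1 / q) *
        (2 powr (p - 1) * (norm e powr (p - 1) + norm (x0 w) powr (p - 1)))
        + 2 powr (1 / q) * q powr (1 / q) * \<bar>u w\<bar> powr (1 / q)) / k"
      using k by (simp add: pos_le_divide_eq mult.commute)
    also have "\<dots> = C * norm e powr (p - 1) + a w"
      by (simp add: C_def D_def a_def add_divide_distrib algebra_simps)
    finally show ?thesis .
  qed
  with bound have "AE w in M. \<forall>e. \<forall>l\<in>clarke_subdifferential (f w) e. norm l \<le> C * norm e powr (p - 1) + a w"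
    by (auto elim!: eventually_mono)
  moreover have "0 \<le> a w" for w using CD by (simp add: a_def)
  ultimately show ?thesis
    using S a CD unfolding condition_S_def condition_S_phi_def by blast
qed

text \<open>
  The \<open>q\<close>-th power of the growth bound has order \<open>(p - 1) * q = p\<close> in \<open>e\<close>. The factor in front of
  \<open>norm e powr p\<close> grows with \<open>k\<close>, but it can be moved into \<open>\<beta>\<close>, as \<open>\<beta>\<close> may depend on \<open>k\<close>; so the constant
  outside can be \<open>1\<close> for every \<open>k\<close>.
\<close>

lemma condition_S_imp_condition_S_phi:
  fixes x0 :: "'w \<Rightarrow> 'a::{real_normed_vector, second_countable_topology}"
  assumes p: "1 < p" and pq: "1 / p + 1 / q = 1" and x0: "x0 \<in> Lp_space p M"
    and S: "condition_S M p q f"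
  shows "condition_S_phi M (power_phi p) x0 f"
proof -
  note q = conjugate_exponent[OF p pq]
  obtain c a where c: "0 < c" and a: "a \<in> Lp_space q M" "\<And>w. w \<in> space M \<Longrightarrow> 0 \<le> a w"
    and bound: "AE w in M. \<forall>e. \<forall>l\<in>clarke_subdifferential (f w) e. norm l \<le> c * norm e powr (p - 1) + a w"
    using S unfolding condition_S_def by blast
  have "\<exists>\<beta>>0. \<exists>u. integrable M u \<and> (AE w in M. \<forall>e.
      (SUP l\<in>clarke_subdifferential (f w) (x0 w + e). conjugate (power_phi p) (k *\<^sub>R l))
        \<le> ereal (1 * power_phi p (\<beta> *\<^sub>R e) + u w))" if k: "1 < k" for k
  proof -
    define C where "C = k powr q / q * 2 powr q"
    define D where "D = C * c powr q * 2 powr p"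
    define \<beta> where "\<beta> = (p * D) powr (1 / p)"
    define u where "u w = D * norm (x0 w) powr p + C * norm (a w) powr q" for w
    have C: "0 < C" and D: "0 < D" using c k q by (simp_all add: C_def D_def)
    have \<beta>: "0 < \<beta>" "\<beta> powr p = p * D" using p D by (simp_all add: \<beta>_def powr_powr)
    have u: "integrable M u"
      using x0 a unfolding u_def Lp_space_def by auto
    have "AE w in M. \<forall>e.
      (SUP l\<in>clarke_subdifferential (f w) (x0 w + e). conjugate (power_phi p) (k *\<^sub>R l))
        \<le> ereal (1 * power_phi p (\<beta> *\<^sub>R e) + u w)"
      using bound AE_space
    proof eventually_elim
      case (elim w)
      show ?case
      proof (intro allI SUP_least)
        fix e l assume "l \<in> clarke_subdifferential (f w) (x0 w + e)"
        with elim have l: "norm l \<le> c * norm (x0 w + e) powr (p - 1) + a w" and aw: "0 \<le> a w"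
          using a(2) by auto
        have "(k * norm l) powr q / q = k powr q / q * norm l powr q"
          using k by (simp add: powr_mult)
        also have "norm l powr q \<le> (c * norm (x0 w + e) powr (p - 1) + a w) powr q"
          using l q by (intro powr_mono2) auto
        also have "\<dots> \<le> 2 powr q * ((c * norm (x0 w + e) powr (p - 1)) powr q + a w powr q)"
          using c aw q by (intro powr_add_le) auto
        also have "\<dots> = 2 powr q * (c powr q * norm (x0 w + e) powr p + a w powr q)"
          using c q by (simp add: powr_mult powr_powr)
        also have "norm (x0 w + e) powr p \<le> (norm (x0 w) + norm e) powr p"
          using p by (intro powr_mono2 norm_triangle_ineq) auto
        also have "\<dots> \<le> 2 powr p * (norm (x0 w) powr p + norm e powr p)"
          using p by (intro powr_add_le) auto
        finally have "(k * norm l) powr q / q \<le> k powr q / q * (2 powr q * (c powr q *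
            (2 powr p * (norm (x0 w) powr p + norm e powr p)) + a w powr q))"
          using q by (simp add: mult_left_mono divide_right_mono)
        also have "\<dots> = D * norm e powr p + u w"
          using aw by (simp add: C_def D_def u_def algebra_simps)
        also have "D * norm e powr p = power_phi p (\<beta> *\<^sub>R e)"
          using \<beta> p by (simp add: power_phi_def powr_mult)
        finally show "conjugate (power_phi p) (k *\<^sub>R l) \<le> ereal (1 * power_phi p (\<beta> *\<^sub>R e) + u w)"
          using k by (simp add: conjugate_power_phi[OF p pq])
      qed
    qed
    with u \<beta> show ?thesis by blast
  qed
  then show ?thesis
    using S unfolding condition_S_def condition_S_phi_def
    by (intro conjI exI[of _ "1::real"]) auto
qed


section \<open>Lower compactness\<close>

lemma measurable_integrand_compose:
  fixes x :: "'w \<Rightarrow> 'a::topological_space"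
  assumes "measurable_integrand M f" "x \<in> borel_measurable M"
  shows "(\<lambda>w. f w (x w)) \<in> borel_measurable M"
proof -
  have "(\<lambda>w. (w, x w)) \<in> measurable M (M \<Otimes>\<^sub>M borel)" using assms(2) by measurable
  from measurable_compose[OF this assms(1)[unfolded measurable_integrand_def]]
  show ?thesis by simp
qed

text \<open>
  On the segment from \<open>x\<close> to \<open>x + r *\<^sub>R y\<close> norms are at most \<open>norm x + r * norm y\<close>, so the mean value
  inequality applies with the corresponding growth bound. The part of order \<open>p\<close> in \<open>y\<close> carries a positive
  power of \<open>r\<close>.
\<close>

lemma difference_quotient_lower_bound:
  fixes g :: "'a::real_normed_vector \<Rightarrow> real"
  assumes lip: "lipschitz_on_balls g" and p: "1 < p" and c: "0 \<le> c" and r: "0 < r"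
    and growth: "\<And>e l. l \<in> clarke_subdifferential g e \<Longrightarrow> norm l \<le> c * norm e powr (p - 1) + a"
  shows "- ((g (x + r *\<^sub>R y) - g x) / r)
    \<le> (c * 2 powr (p - 1) * norm x powr (p - 1) + a) * norm y
      + c * 2 powr (p - 1) * r powr (p - 1) * norm y powr p"
proof -
  define K where "K = c * (norm x + r * norm y) powr (p - 1) + a"
  have "g x - g (x + r *\<^sub>R y) \<le> K * norm (x - (x + r *\<^sub>R y))"
  proof (rule clarke_mean_value_inequality[OF lip])
    fix z l assume z: "z \<in> closed_segment (x + r *\<^sub>R y) x" and l: "l \<in> clarke_subdifferential g z"
    have "norm (z - x) \<le> norm (x + r *\<^sub>R y - x)"
      using segment_bound(2)[OF z] by (simp add: norm_minus_commute)
    then have "norm z \<le> norm x + r * norm y"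
      using norm_triangle_ineq[of "z - x" x] r by simp
    then have "c * norm z powr (p - 1) \<le> c * (norm x + r * norm y) powr (p - 1)"
      using c p by (intro mult_left_mono powr_mono2) auto
    with growth[OF l] show "norm l \<le> K" by (simp add: K_def)
  qed
  then have "- ((g (x + r *\<^sub>R y) - g x) / r) \<le> K * norm y"
    using r by (simp add: field_simps)
  also have "K \<le> c * (2 powr (p - 1) * (norm x powr (p - 1) + (r * norm y) powr (p - 1))) + a"
    unfolding K_def using p c r by (intro add_right_mono mult_left_mono powr_add_le) auto
  also have "(r * norm y) powr (p - 1) = r powr (p - 1) * norm y powr (p - 1)"
    using r by (simp add: powr_mult)
  also have "(c * (2 powr (p - 1) * (norm x powr (p - 1) + r powr (p - 1) * norm y powr (p - 1))) + a) * norm y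
    = (c * 2 powr (p - 1) * norm x powr (p - 1) + a) * norm y
      + c * 2 powr (p - 1) * r powr (p - 1) * (norm y powr (p - 1) * norm y)"
    by (simp add: algebra_simps)
  also have "norm y powr (p - 1) * norm y = norm y powr p"
    using powr_add[of "norm y" "p - 1" 1] by simp
  finally show ?thesis by (simp add: mult_right_mono)
qed

text \<open>
  A small \<open>\<delta>\<close> makes the contribution of \<open>N\<close> small at the cost of a large multiple of \<open>h powr q\<close>.
\<close>

lemma Young_scaled:
  fixes h N :: real
  assumes p: "1 < p" and pq: "1 / p + 1 / q = 1" and pos: "0 \<le> h" "0 \<le> N" "0 < \<delta>"
  shows "h * N \<le> (h / \<delta>) powr q + \<delta> powr p * N powr p"
proof -
  note q = conjugate_exponent[OF p pq]
  have "h * N = (\<delta> * N) * (h / \<delta>)" using pos by simp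
  also have "\<dots> \<le> (\<delta> * N) powr p / p + (h / \<delta>) powr q / q"
    using assms q by (intro Youngs_inequality) auto
  also have "\<dots> \<le> (\<delta> * N) powr p + (h / \<delta>) powr q"
    using p q by (intro add_mono) (simp_all add: divide_le_eq mult_le_cancel_left1)
  finally show ?thesis using pos by (simp add: powr_mult)
qed

text \<open>
  By the two preceding lemmas the negative parts are dominated by \<open>(h w / \<delta>) powr q\<close>, a fixed integrable
  function, plus \<open>norm (x n w) powr p\<close> with the factor \<open>\<delta> powr p + D * r n powr (p - 1)\<close>. Since the
  sequence is bounded in \<open>L\<^sub>p\<close> and \<open>r n\<close> tends to \<open>0\<close>, the integral of the second term is eventually as
  small as required once \<open>\<delta>\<close> is small.
\<close>

lemma condition_S_imp_frechet_lower_compactness: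
  fixes x0 :: "'w \<Rightarrow> 'a::{real_normed_vector, second_countable_topology}"
  assumes p: "1 < p" and pq: "1 / p + 1 / q = 1" and f: "measurable_integrand M f"
    and S: "condition_S M p q f" and x0: "x0 \<in> Lp_space p M"
  shows "frechet_lower_compactness M p x0 f"
  unfolding frechet_lower_compactness_def
proof (intro allI impI exI[of _ 0])
  fix r :: "nat \<Rightarrow> real" and x :: "nat \<Rightarrow> 'w \<Rightarrow> 'a"
  assume r: "\<forall>n. 0 < r n" "r \<longlonglongrightarrow> 0" and x: "\<forall>n. x n \<in> Lp_space p M"
    and "\<exists>B. \<forall>n. Lp_norm p M (x n) \<le> B"
  then obtain B where B: "\<And>n. Lp_norm p M (x n) \<le> B" by blast
  note q = conjugate_exponent[OF p pq]
  obtain c a where c: "0 < c" and a: "a \<in> Lp_space q M" "\<And>w. w \<in> space M \<Longrightarrow> 0 \<le> a w"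
    and lip: "AE w in M. lipschitz_on_balls (f w)"
    and bound: "AE w in M. \<forall>e. \<forall>l\<in>clarke_subdifferential (f w) e. norm l \<le> c * norm e powr (p - 1) + a w"
    using S unfolding condition_S_def by blast
  define u where "u n w = max 0 (- ((f w (x0 w + r n *\<^sub>R x n w) - f w (x0 w)) / r n))" for n w
  define D where "D = c * 2 powr (p - 1)"
  have D: "0 \<le> D" using c by (simp add: D_def)
  \<comment> \<open>The function \<open>a\<close> is nonnegative on the space only.\<close>
  define h where "h w = D * norm (x0 w) powr (p - 1) + 1 * \<bar>a w\<bar>" for w
  have "(\<lambda>w. \<bar>a w\<bar>) \<in> Lp_space q M" using a(1) by (auto simp: Lp_space_def)
  then have h: "h \<in> Lp_space q M"
    unfolding h_def using D q Lp_space_norm_powr[OF x0 q(2)] by (intro Lp_space_scale_add) auto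
  have h0: "0 \<le> h w" for w using D by (simp add: h_def)
  define J where "J n w = norm (x n w) powr p" for n w
  have J: "integrable M (J n)" "0 \<le> J n w" for n w
    using x[rule_format, of n] unfolding J_def Lp_space_def by simp_all
  have JB: "(LINT w|M. J n w) \<le> \<bar>B\<bar> powr p" for n
  proof -
    have "0 \<le> (LINT w|M. J n w)" using J by simp
    then have "(LINT w|M. J n w) = (Lp_norm p M (x n)) powr p"
      using p by (simp add: Lp_norm_def J_def powr_powr)
    also have "\<dots> \<le> \<bar>B\<bar> powr p"
      using B[of n] p by (intro powr_mono2) (auto simp: Lp_norm_def)
    finally show ?thesis .
  qed
  have dom: "AE w in M. \<bar>u n w\<bar> \<le> (h w / \<delta>) powr q + (\<delta> powr p + D * r n powr (p - 1)) * J n w"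
    if \<delta>: "0 < \<delta>" for n \<delta>
    using lip bound AE_space
  proof eventually_elim
    case (elim w)
    have "- ((f w (x0 w + r n *\<^sub>R x n w) - f w (x0 w)) / r n)
        \<le> (c * 2 powr (p - 1) * norm (x0 w) powr (p - 1) + a w) * norm (x n w)
          + c * 2 powr (p - 1) * r n powr (p - 1) * norm (x n w) powr p"
      using elim c r p by (intro difference_quotient_lower_bound) auto
    also have "\<dots> = h w * norm (x n w) + D * r n powr (p - 1) * J n w"
      using a(2)[OF elim(3)] by (simp add: h_def D_def J_def)
    also have "h w * norm (x n w) \<le> (h w / \<delta>) powr q + \<delta> powr p * J n w"
      unfolding J_def using \<delta> h0 by (intro Young_scaled p pq) auto
    finally have "- ((f w (x0 w + r n *\<^sub>R x n w) - f w (x0 w)) / r n)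
        \<le> (h w / \<delta>) powr q + (\<delta> powr p + D * r n powr (p - 1)) * J n w"
      by (simp add: algebra_simps)
    moreover have "0 \<le> (h w / \<delta>) powr q + (\<delta> powr p + D * r n powr (p - 1)) * J n w"
      using D J by simp
    ultimately show ?case by (simp add: u_def)
  qed
  have H: "integrable M (\<lambda>w. (h w / \<delta>) powr q)" if "0 < \<delta>" for \<delta>
    using h h0 that by (simp add: Lp_space_def powr_divide)
  have u: "integrable M (u n)" for n
  proof (rule Bochner_Integration.integrable_bound)
    show "integrable M (\<lambda>w. (h w / 1) powr q + (1 powr p + D * r n powr (p - 1)) * J n w)"
      using J(1) H[of 1] by auto
    show "AE w in M. norm (u n w) \<le> norm ((h w / 1) powr q + (1 powr p + D * r n powr (p - 1)) * J n w)"
      using dom[of 1 n] by (auto elim!: eventually_mono)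
    have [measurable]: "x0 \<in> borel_measurable M" "x n \<in> borel_measurable M"
      using x0 x by (auto simp: Lp_space_def)
    have [measurable]: "(\<lambda>w. f w (x0 w)) \<in> borel_measurable M"
      "(\<lambda>w. f w (x0 w + r n *\<^sub>R x n w)) \<in> borel_measurable M"
      by (auto intro!: measurable_integrand_compose[OF f])
    show "u n \<in> borel_measurable M" unfolding u_def by measurable
  qed
  have "uniformly_integrable M (range u)"
  proof (rule uniformly_integrable_rangeI[OF u])
    fix e :: real assume e: "0 < e"
    \<comment> \<open>Each of the two parts of the factor of \<open>J n\<close> will be at most \<open>\<gamma>\<close>.\<close>
    define \<gamma> where "\<gamma> = e / (2 * (\<bar>B\<bar> powr p + 1))"
    have B1: "0 < \<bar>B\<bar> powr p + 1" using powr_ge_zero[of "\<bar>B\<bar>" p] by linarith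
    have \<gamma>: "0 < \<gamma>" using e B1 by (simp add: \<gamma>_def)
    have "2 * \<gamma> * t = e" if "t = \<bar>B\<bar> powr p + 1" for t
      using B1 by (simp add: \<gamma>_def flip: that)
    then have \<gamma>e: "2 * \<gamma> * \<bar>B\<bar> powr p \<le> e"
      using \<gamma> mult_left_mono[of "\<bar>B\<bar> powr p" "\<bar>B\<bar> powr p + 1" "2 * \<gamma>"] by simp
    define \<delta> where "\<delta> = \<gamma> powr (1 / p)"
    have \<delta>: "0 < \<delta>" "\<delta> powr p = \<gamma>" using \<gamma> p by (simp_all add: \<delta>_def powr_powr)
    define g where "g n w = (\<delta> powr p + D * r n powr (p - 1)) * J n w" for n w
    have "(\<lambda>n. D * r n powr (p - 1)) \<longlonglongrightarrow> D * 0"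
      using r p by (intro tendsto_mult_left tendsto_powr'[where b = "p - 1" and a = 0, simplified])
        (auto intro!: always_eventually less_imp_le)
    then have "\<forall>\<^sub>F n in sequentially. D * r n powr (p - 1) < \<gamma>"
      using \<gamma> by (intro order_tendstoD(2)[of _ "D * 0"]) auto
    then have "\<forall>\<^sub>F n in sequentially. (LINT w|M. g n w) \<le> e"
    proof eventually_elim
      case (elim n)
      have "(LINT w|M. g n w) = (\<gamma> + D * r n powr (p - 1)) * (LINT w|M. J n w)"
        by (simp add: g_def \<delta>)
      also have "\<dots> \<le> (\<gamma> + \<gamma>) * \<bar>B\<bar> powr p"
        using elim JB[of n] J \<gamma> D by (intro mult_mono) auto
      finally show ?case using \<gamma>e by simp
    qed
    moreover have "integrable M (g n)" "0 \<le> g n w" for n w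
      unfolding g_def using J D by simp_all
    ultimately show "\<exists>H g. integrable M H \<and> (\<forall>w. 0 \<le> H w) \<and>
      (\<forall>n. integrable M (g n) \<and> (\<forall>w. 0 \<le> g n w) \<and> (AE w in M. \<bar>u n w\<bar> \<le> H w + g n w)) \<and>
      (\<forall>\<^sub>F n in sequentially. (LINT w|M. g n w) \<le> e)"
      using H[OF \<delta>(1)] dom[OF \<delta>(1)]
      by (intro exI[of _ "\<lambda>w. (h w / \<delta>) powr q"] exI[of _ g]) (auto simp: g_def)
  qed
  moreover have "range u = (\<lambda>n w. max 0 (- ((f w (x0 w + r n *\<^sub>R x n w) - f w (x0 w)) / r n))) ` {0..}"
    by (auto simp: u_def image_def fun_eq_iff)
  ultimately show "uniformly_integrable M
      ((\<lambda>n w. max 0 (- ((f w (x0 w + r n *\<^sub>R x n w) - f w (x0 w)) / r n))) ` {0..})"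
    by simp
qed

theorem corollary8p16:
  fixes M :: "'w measure"
    and f :: "'w \<Rightarrow> 'a::{banach, second_countable_topology} \<Rightarrow> real"
    and p q :: real
  assumes "sigma_finite_measure M" and "complete_measure M"
    and "1 < p" and "1 / p + 1 / q = 1"
    and "measurable_integrand M f"
  shows "((\<forall>x0\<in>Lp_space p M. condition_S_phi M (power_phi p) x0 f) \<longleftrightarrow>
          (\<exists>x0\<in>Lp_space p M. condition_S_phi M (power_phi p) x0 f))
       \<and> ((\<exists>x0\<in>Lp_space p M. condition_S_phi M (power_phi p) x0 f) \<longleftrightarrow> condition_S M p q f)
       \<and> (condition_S M p q f \<longrightarrow>
            (\<forall>x0\<in>Lp_space p M. frechet_lower_compactness M p x0 f))"
proof -
  have "(\<lambda>_. 0) \<in> (Lp_space p M :: ('w \<Rightarrow> 'a) set)"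
    by (simp add: Lp_space_def)
  then show ?thesis
    using condition_S_phi_imp_condition_S[OF assms(3,4)] condition_S_imp_condition_S_phi[OF assms(3,4)]
      condition_S_imp_frechet_lower_compactness[OF assms(3,4,5)]
    by blast
qed

end
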